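(* Let $A$ be a $3\times 3$ skew-symmetric integer matrix whose associated quiver is connected, which is mutation-acyclic and mutation-infinite, and let $g\in\mathbb{Z}^3$ be nonzero with $Ag=0$. Then the graded cluster algebra $\mathcal{A}((x_1,x_2,x_3),A,g)$ has infinitely many cluster variables in each occurring degree. Moreover, the grading is balanced.
   Context: Matrix mutation: for a $3\times3$ skew-symmetric integer matrix $B=(b_{ij})$ and $k\in\{1,2,3\}$, $\mu_k(B)=(b'_{ij})$ with $b'_{ij}=-b_{ij}$ if $i=k$ or $j=k$, and $b'_{ij}=b_{ij}+\operatorname{sgn}(b_{ik})\max(b_{ik}b_{kj},0)$ otherwise. The mutation class of $B$ is the set of matrices obtained from $B$ by finite sequences of mutations; $B$ is mutation-infinite if its mutation class is infinite. The quiver of $B$ has $b_{ij}$ arrows $i\to j$ when $b_{ij}>0$; $B$ is acyclic if this quiver has no oriented cycle, and mutation-acyclic if some matrix in its mutation class is acyclic. Graded cluster algebras: a seed $((x_1,x_2,x_3),B)$ mutates in direction $k$ to $(x',\mu_k B)$ with $x'_j=x_j$ ($j\ne k$) and $x'_k=\big(\prod_{b_{ik}>0}x_i^{b_{ik}}+\prod_{b_{ik}<0}x_i^{-b_{ik}}\big)/x_k$. Cluster variables are all entries of clusters reachable by iterated mutation, and $\mathcal{A}(x,B,g)$ is the algebra they generate, graded by $\deg x_i=g_i$ where $Bg=0$; under mutation at $k$ the degree vector becomes $g'$ with $g'_j=g_j$ ($j\neq k$) and $g'_k=-g_k+\sum_{b_{ik}>0}b_{ik}g_i$; every cluster variable is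 homogeneous. A degree occurs if some cluster variable has that degree. The grading is balanced if for every $d$ there is a bijection between the cluster variables of degree $d$ and those of degree $-d$. *)

theory Defs
  imports "HOL-Analysis.Analysis"
begin

text \<open>3x3 integer matrices are indexed by the finite type 3; entry b_ij is B$i$j.\<close>

type_synonym imat3 = "int^3^3"

definition skew_sym :: "imat3 \<Rightarrow> bool" where
  "skew_sym B \<longleftrightarrow> (\<forall>i j. B$i$j = - B$j$i)"

definition mut :: "3 \<Rightarrow> imat3 \<Rightarrow> imat3" where
  "mut k B = (\<chi> i j. if i = k \<or> j = k then - B$i$j
       else B$i$j + sgn (B$i$k) * max (B$i$k * B$k$j) 0)"

inductive_set mutation_class :: "imat3 \<Rightarrow> imat3 set" for B where
  refl: "B \<in> mutation_class B"
| step: "C \<in> mutation_class B \<Longrightarrow> mut k C \<in> mutation_class B"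

definition mutation_infinite :: "imat3 \<Rightarrow> bool" where
  "mutation_infinite B \<longleftrightarrow> infinite (mutation_class B)"

text \<open>Arrow relation of the quiver: i \<rightarrow> j iff b_ij > 0.\<close>
definition quiver_arrows :: "imat3 \<Rightarrow> (3 \<times> 3) set" where
  "quiver_arrows B = {(i, j). B$i$j > 0}"

definition is_acyclic :: "imat3 \<Rightarrow> bool" where
  "is_acyclic B \<longleftrightarrow> acyclic (quiver_arrows B)"

definition mutation_acyclic :: "imat3 \<Rightarrow> bool" where
  "mutation_acyclic B \<longleftrightarrow> (\<exists>C \<in> mutation_class B. is_acyclic C)"

text \<open>Connectedness of the underlying (undirected) graph of the quiver.\<close>
definition quiver_connected :: "imat3 \<Rightarrow> bool" where
  "quiver_connected B \<longleftrightarrow>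
     (\<forall>i j. (i, j) \<in> ({(a, b). B$a$b \<noteq> 0 \<or> B$b$a \<noteq> 0})\<^sup>*)"

text \<open>Cluster variables are rational functions in x_1,x_2,x_3 given by subtraction-free
expressions; we represent them by their (well-defined) values at points of the positive
orthant, which determines a rational function uniquely. Outside the orthant the
function is set to 0.\<close>

type_synonym cvar = "(3 \<Rightarrow> real) \<Rightarrow> real"
type_synonym seed = "(3 \<Rightarrow> cvar) \<times> imat3 \<times> (int^3)"

definition pos_pt :: "(3 \<Rightarrow> real) \<Rightarrow> bool" where
  "pos_pt t \<longleftrightarrow> (\<forall>i. t i > 0)"

definition exchange :: "3 \<Rightarrow> (3 \<Rightarrow> cvar) \<Rightarrow> imat3 \<Rightarrow> cvar" where
  "exchange k x B = (\<lambda>t. if pos_pt t then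
      ((\<Prod>i\<in>UNIV. if B$i$k > 0 then x i t ^ nat (B$i$k) else 1)
     + (\<Prod>i\<in>UNIV. if B$i$k < 0 then x i t ^ nat (- B$i$k) else 1)) / x k t
      else 0)"

definition deg_mut :: "3 \<Rightarrow> imat3 \<Rightarrow> int^3 \<Rightarrow> int^3" where
  "deg_mut k B g = (\<chi> j. if j = k then - g$k + (\<Sum>i\<in>{i. B$i$k > 0}. B$i$k * g$i) else g$j)"

definition seed_mut :: "3 \<Rightarrow> seed \<Rightarrow> seed" where
  "seed_mut k s = (case s of (x, B, g) \<Rightarrow>
      (x(k := exchange k x B), mut k B, deg_mut k B g))"

definition initial_cluster :: "3 \<Rightarrow> cvar" where
  "initial_cluster i = (\<lambda>t. if pos_pt t then t i else 0)"

inductive_set reachable_seeds :: "imat3 \<Rightarrow> int^3 \<Rightarrow> seed set" for A g where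
  init: "(initial_cluster, A, g) \<in> reachable_seeds A g"
| step: "s \<in> reachable_seeds A g \<Longrightarrow> seed_mut k s \<in> reachable_seeds A g"

text \<open>Cluster variables of degree d in the graded cluster algebra A(x, A, g).\<close>
definition cluster_vars_of_degree :: "imat3 \<Rightarrow> int^3 \<Rightarrow> int \<Rightarrow> cvar set" where
  "cluster_vars_of_degree A g d =
     {v. \<exists>x B h i. (x, B, h) \<in> reachable_seeds A g \<and> v = x i \<and> h$i = d}"

definition degree_occurs :: "imat3 \<Rightarrow> int^3 \<Rightarrow> int \<Rightarrow> bool" where
  "degree_occurs A g d \<longleftrightarrow> cluster_vars_of_degree A g d \<noteq> {}"

definition balanced_grading :: "imat3 \<Rightarrow> int^3 \<Rightarrow> bool" where
  "balanced_grading A g \<longleftrightarrow> (\<forall>d. \<exists>f. bij_betw f (cluster_vars_of_degree A g d)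
                                              (cluster_vars_of_degree A g (-d)))"

end

theory Submission
  imports Defs
begin

text \<open>
  Write a skew-symmetric \<open>B\<close> as the triple \<open>m = (b\<^sub>2\<^sub>3, b\<^sub>3\<^sub>1, b\<^sub>1\<^sub>2)\<close>, which spans its kernel if it is
  not zero. Up to a sign of \<open>B\<close> that alternates under mutation, the degree vector therefore is a
  fixed multiple of \<open>m\<close> throughout, so that the degrees are the multiples of the entries of the triples.

  Evaluate the cluster variables at the positive point at which an acyclic seed takes the values
  \<open>(1, 1, 1)\<close>. Mutations of this seed at sources and sinks only change signs in \<open>m\<close>, and the values
  tend to infinity in both directions of this acyclic belt. If the belt is left late, then every further
  mutation away from it produces a value at least as large as the previous ones. Edges of multiplicity 1,
  for which this fails, are harmless because the triples that they produce agree up to a permutation with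
  triples found elsewhere. Hence if \<open>d\<close> occurs, the values of the variables of degree \<open>d\<close> are unbounded,
  and so are those of degree \<open>-d\<close>: both sets are countably infinite.
\<close>

section \<open>Exchange matrices as triples of integers\<close>

definition distinct3 :: "3 \<Rightarrow> 3 \<Rightarrow> 3 \<Rightarrow> bool" where
  "distinct3 i j k \<longleftrightarrow> i \<noteq> j \<and> i \<noteq> k \<and> j \<noteq> k"

lemma distinct3_succ: "distinct3 i (i + 1) (i + 2)"
  using exhaust_3[of i] by (auto simp: distinct3_def)

lemma distinct3_succ_cases:
  assumes "distinct3 i j k"
  shows "j = i + 1 \<and> k = i + 2 \<or> j = i + 2 \<and> k = i + 1"
  using assms exhaust_3[of i] exhaust_3[of j] exhaust_3[of k] by (auto simp: distinct3_def)

lemma distinct3_UNIV: "distinct3 i j k \<Longrightarrow> (UNIV :: 3 set) = {i, j, k}"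
  using exhaust_3[of i] exhaust_3[of j] exhaust_3[of k] by (auto simp: distinct3_def UNIV_3)

lemma distinct3_all: "distinct3 i j k \<Longrightarrow> (\<forall>x. P x) \<longleftrightarrow> P i \<and> P j \<and> P k"
  using distinct3_UNIV[of i j k] by (metis UNIV_I insertE singletonD)

lemma distinct3_exhaust: "distinct3 i j k \<Longrightarrow> x = i \<or> x = j \<or> x = k"
  using distinct3_UNIV[of i j k] by blast

lemma distinct3_third:
  assumes "i \<noteq> k" obtains j where "distinct3 i j k"
proof
  \<comment> \<open>The three elements of the index type sum to 0.\<close>
  show "distinct3 i (- (i + k)) k"
    using assms exhaust_3[of i] exhaust_3[of k] by (auto simp: distinct3_def)
qed

section \<open>Mutation of triples and of values\<close>

definition tmut :: "3 \<Rightarrow> (3 \<Rightarrow> int) \<Rightarrow> 3 \<Rightarrow> int" where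
  "tmut i m = m(i := - m i + sgn (m (i + 1)) * max (m (i + 1) * m (i + 2)) 0)"

text \<open>Up to sign, \<open>m (i + 2)\<close> and \<open>m (i + 1)\<close> are the entries of
  column \<open>i\<close> in rows \<open>i + 1\<close> and \<open>i + 2\<close>. If they have the
  same sign, \<open>i\<close> has arrows in and out and both monomials are single powers; otherwise
  one monomial is 1. A global sign change of \<open>m\<close> has no effect.\<close>

definition vmut :: "3 \<Rightarrow> (3 \<Rightarrow> int) \<Rightarrow> (3 \<Rightarrow> real) \<Rightarrow> 3 \<Rightarrow> real" where
  "vmut i m v = v(i := (if m (i + 1) * m (i + 2) > 0
      then v (i + 1) ^ nat \<bar>m (i + 2)\<bar> + v (i + 2) ^ nat \<bar>m (i + 1)\<bar>
      else 1 + v (i + 1) ^ nat \<bar>m (i + 2)\<bar> * v (i + 2) ^ nat \<bar>m (i + 1)\<bar>) / v i)"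

text \<open>The correction term vanishes unless the two other entries have a common sign, and then
  either may supply it. So the cyclic order of the indices is irrelevant.\<close>

lemma tmut_eq:
  assumes "distinct3 i j k"
  shows "tmut i m = m(i := - m i + sgn (m j) * max (m j * m k) 0)"
proof -
  have "sgn a * max (a * b) 0 = sgn b * max (b * a) 0" for a b :: int
    by (auto simp: max_def sgn_if mult.commute zero_less_mult_iff mult_le_0_iff zero_le_mult_iff)
  then show ?thesis
    using distinct3_succ_cases[OF assms] by (auto simp: tmut_def)
qed

lemma vmut_eq:
  assumes "distinct3 i j k"
  shows "vmut i m v = v(i := (if m j * m k > 0
      then v j ^ nat \<bar>m k\<bar> + v k ^ nat \<bar>m j\<bar>
      else 1 + v j ^ nat \<bar>m k\<bar> * v k ^ nat \<bar>m j\<bar>) / v i)"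
  using distinct3_succ_cases[OF assms] by (auto simp: vmut_def ac_simps)

lemma tmut_tmut [simp]: "tmut i (tmut i m) = m"
  using distinct3_succ[of i] unfolding tmut_def by (auto simp: fun_eq_iff distinct3_def)

lemma vmut_pos: "(\<And>x. 0 < v x) \<Longrightarrow> 0 < vmut i m v x"
  by (auto simp: vmut_def add_pos_pos)

lemma vmut_vmut:
  assumes "\<And>x. 0 < v x"
  shows "vmut i (tmut i m) (vmut i m v) = v"
proof -
  note d = distinct3_succ[of i]
  have v: "v i \<noteq> 0" "v (i+1) > 0" "v (i+2) > 0" using assms less_irrefl by metis+
  have p: "v (i+1) ^ a + v (i+2) ^ b \<noteq> 0" "1 + v (i+1) ^ a * v (i+2) ^ b \<noteq> 0" for a b
    using v by (smt (verit) mult_pos_pos zero_less_power)+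
  show ?thesis
    using d v p by (auto simp: fun_eq_iff vmut_def tmut_def distinct3_def)
qed

lemma tmut_equivariant:
  assumes "bij \<sigma>" and "s \<in> {1, -1}"
  shows "tmut i (\<lambda>x. s * n (\<sigma> x)) = (\<lambda>x. s * tmut (\<sigma> i) n (\<sigma> x))"
proof -
  have inj: "\<sigma> x = \<sigma> y \<longleftrightarrow> x = y" for x y
    using assms(1) by (metis bij_pointE)
  have d: "distinct3 (\<sigma> i) (\<sigma> (i + 1)) (\<sigma> (i + 2))"
    using distinct3_succ[of i] by (simp add: distinct3_def inj)
  show ?thesis
    unfolding tmut_eq[OF d] using assms(2)
    by (auto simp: tmut_def fun_eq_iff inj sgn_mult)
qed

text \<open>Mixed or vanishing signs of \<open>n\<close> mean that the quiver has no oriented cycle.\<close>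

definition belt :: "(3 \<Rightarrow> int) \<Rightarrow> (3 \<Rightarrow> int) \<Rightarrow> bool" where
  "belt p n \<longleftrightarrow> (\<forall>x. \<bar>n x\<bar> = p x) \<and> \<not> (\<forall>x. 0 < n x) \<and> \<not> (\<forall>x. n x < 0)"

text \<open>Cyclic quivers met after leaving the belt, normalized to positive entries;
  \<open>k\<close> marks the newest entry, for \<open>p\<close> nonnegative also a largest one. A
  step with \<open>n j = 1\<close> is left out because its new entry \<open>n k - n i\<close> would
  be smaller than \<open>n k\<close>.\<close>

inductive branch :: "(3 \<Rightarrow> int) \<Rightarrow> 3 \<Rightarrow> (3 \<Rightarrow> int) \<Rightarrow> bool" for p where
  base: "distinct3 i j k \<Longrightarrow> 1 \<le> p i \<Longrightarrow> 1 \<le> p j \<Longrightarrow> branch p k (p(k := p k + p i * p j))"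
| step: "branch p k n \<Longrightarrow> distinct3 i j k \<Longrightarrow> 2 \<le> n j \<Longrightarrow> branch p i (tmut i n)"

text \<open>The sign is needed because the belt can be left with either sign, the permutation
  because the steps left out of \<open>branch\<close> lead back only up to a transposition.\<close>

definition orbit_hull :: "(3 \<Rightarrow> int) \<Rightarrow> (3 \<Rightarrow> int) set" where
  "orbit_hull p = {m. \<exists>s \<sigma> n. s \<in> {1, -1} \<and> bij \<sigma> \<and> (belt p n \<or> (\<exists>k. branch p k n))
      \<and> m = (\<lambda>x. s * n (\<sigma> x))}"

section \<open>Closure of the hull under mutation\<close>

lemma orbit_hullI:
  assumes "s \<in> {1, -1}" "bij \<sigma>" "belt p n \<or> (\<exists>k. branch p k n)" "m = (\<lambda>x. s * n (\<sigma> x))"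
  shows "m \<in> orbit_hull p"
  using assms unfolding orbit_hull_def by blast

lemma orbit_hull_base:
  assumes "belt p n \<or> (\<exists>k. branch p k n)"
  shows "n \<in> orbit_hull p"
  using assms by (intro orbit_hullI[of 1 id]) auto

lemma orbit_hull_equivariant:
  assumes "n \<in> orbit_hull p" "s \<in> {1, -1}" "bij \<sigma>"
  shows "(\<lambda>x. s * n (\<sigma> x)) \<in> orbit_hull p"
proof -
  obtain s' \<sigma>' n' where n': "s' \<in> {1, -1}" "bij \<sigma>'" "belt p n' \<or> (\<exists>k. branch p k n')"
    "n = (\<lambda>x. s' * n' (\<sigma>' x))"
    using assms(1) unfolding orbit_hull_def by blast
  show ?thesis
    using n' assms(2,3) by (intro orbit_hullI[of "s * s'" "\<sigma>' \<circ> \<sigma>" p n']) (auto simp: bij_comp)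
qed

lemma tmut_cyclic:
  assumes "distinct3 i j k" "0 < m j" "0 < m k"
  shows "tmut i m = m(i := m j * m k - m i)"
  using assms by (simp add: tmut_eq)

text \<open>In a step, \<open>n j * n k - n i\<close> is at least \<open>2 * n k - n i\<close>,
  hence at least \<open>n k\<close>, so the new entry is the new maximum. As \<open>n k\<close> and
  \<open>n j\<close> are at least 2, an entry 1 can survive only at the first level.\<close>

lemma branch_bounds:
  assumes "branch p k n" and "\<And>x. 0 \<le> p x"
  shows "(\<forall>x. 1 \<le> n x \<and> n x \<le> n k) \<and>
    ((\<exists>i j. distinct3 i j k \<and> 1 \<le> p i \<and> 1 \<le> p j \<and> n = p(k := p k + p i * p j)) \<or> (\<forall>x. 2 \<le> n x))"
  using assms(1)
proof induction
  case (base i j k)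
  define q where "q = p i * p j"
  have "p i \<le> q" "p j \<le> q"
    unfolding q_def using base by (simp_all add: mult_le_cancel_left1 mult_le_cancel_right1)
  moreover have "i \<noteq> k" "j \<noteq> k" "0 \<le> p k" using base assms(2) by (auto simp: distinct3_def)
  ultimately have "\<forall>x. 1 \<le> (p(k := p k + q)) x \<and> (p(k := p k + q)) x \<le> (p(k := p k + q)) k"
    using base by (subst distinct3_all[OF base(1)]) auto
  then have "\<forall>x. 1 \<le> (p(k := p k + p i * p j)) x
      \<and> (p(k := p k + p i * p j)) x \<le> (p(k := p k + p i * p j)) k"
    unfolding q_def .
  then show ?case using base by blast
next
  case (step k n i j)
  have n: "1 \<le> n i" "n i \<le> n k" "n j \<le> n k" "2 \<le> n j" "i \<noteq> k" "j \<noteq> i" "i \<noteq> j"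
    using step by (auto simp: distinct3_def)
  have t: "tmut i n = n(i := n j * n k - n i)"
    using step n by (intro tmut_cyclic) auto
  define q where "q = n j * n k"
  have "2 * n k \<le> q" unfolding q_def using n by (intro mult_right_mono) auto
  then have "\<forall>x. 2 \<le> tmut i n x \<and> tmut i n x \<le> tmut i n i"
    using n unfolding t q_def[symmetric] by (subst distinct3_all[OF step(2)]) auto
  moreover from this have "\<forall>x. 1 \<le> tmut i n x"
    by (auto intro: order_trans[of 1 2])
  ultimately show ?case by blast
qed

text \<open>Unless the two other entries have a common sign, \<open>i\<close> is a source or a sink
  and only a sign changes. Otherwise the mutation leaves the belt and starts a branch.\<close>

lemma tmut_belt:
  assumes "belt p n" and "\<And>x. 0 \<le> p x"
  shows "tmut i n \<in> orbit_hull p"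
proof -
  define j k where "j = i + 1" and "k = i + 2"
  have d: "distinct3 i j k" unfolding j_def k_def by (rule distinct3_succ)
  have ne: "j \<noteq> i" "k \<noteq> i" using d by (auto simp: distinct3_def)
  have abs: "\<bar>n x\<bar> = p x" for x using assms by (auto simp: belt_def)
  have mixed: "\<not> (0 < n i \<and> 0 < n j \<and> 0 < n k)" "\<not> (n i < 0 \<and> n j < 0 \<and> n k < 0)"
    using assms(1) unfolding belt_def distinct3_all[OF d] by auto
  show ?thesis
  proof (cases "n j * n k > 0")
    case False
    then have "tmut i n = n(i := - n i)"
      by (simp add: tmut_eq[OF d])
    moreover have "belt p (n(i := - n i))"
      using assms False ne abs unfolding belt_def distinct3_all[OF d]
      by (auto simp: zero_less_mult_iff)
    ultimately show ?thesis by (simp add: orbit_hull_base)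
  next
    case True
    \<comment> \<open>The signs are mixed, so \<open>n i\<close> is zero or of sign opposite to
      \<open>s\<close>; hence \<open>- n i\<close> and the correction term add up without
      cancellation.\<close>
    define s where "s = sgn (n j)"
    have s: "s \<in> {1, -1}" "n j = s * p j" "n k = s * p k" "n i = - (s * p i)"
      using True mixed abs[of i] abs[of j] abs[of k] unfolding s_def
      by (auto simp: zero_less_mult_iff sgn_if)
    have "n j * n k = p j * p k" "1 \<le> p j" "1 \<le> p k"
      using True s abs[of j] abs[of k] by (auto simp: zero_less_mult_iff)
    then have "tmut i n = (\<lambda>x. s * (p(i := p i + p j * p k)) x)"
      using s True ne distinct3_exhaust[OF d] unfolding tmut_eq[OF d] s_def[symmetric]
      by (auto simp: fun_eq_iff distrib_left)
    moreover have "p(i := p i + p j * p k) \<in> orbit_hull p"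
      using d \<open>1 \<le> p j\<close> \<open>1 \<le> p k\<close> by (intro orbit_hull_base disjI2 exI[of _ i] branch.base) (auto simp: distinct3_def)
    ultimately show ?thesis
      using orbit_hull_equivariant[OF _ s(1) bij_id] by (simp only: id_apply)
  qed
qed

text \<open>Mutating the newest entry of a branch undoes the last step. If \<open>p j = 1\<close>, the first level
  of the branches is closed up to a transposition: this is the pentagon of type \<open>A\<^sub>2\<close>.\<close>

lemma tmut_branch_newest:
  assumes "branch p k n" and "\<And>x. 0 \<le> p x"
  shows "tmut k n \<in> orbit_hull p"
  using assms(1)
proof cases
  case (base i j)
  then have "tmut k n = p(k := - p k)"
    using tmut_cyclic[of k i j n] by (auto simp: distinct3_def)
  moreover have "belt p (p(k := - p k))"
    using base assms(2)[of k] unfolding belt_def distinct3_all[OF base(2)]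
    by (auto simp: distinct3_def)
  ultimately show ?thesis by (simp add: orbit_hull_base)
next
  case (step k' n' j)
  then show ?thesis by (auto intro: orbit_hull_base)
qed

lemma tmut_branch:
  assumes "branch p k n" and p: "\<And>x. 0 \<le> p x"
  shows "tmut i n \<in> orbit_hull p"
proof (cases "i = k")
  case True
  then show ?thesis using assms tmut_branch_newest by simp
next
  case False
  then obtain j where d: "distinct3 i j k" by (rule distinct3_third)
  then have ne: "i \<noteq> j" "i \<noteq> k" "j \<noteq> k" by (auto simp: distinct3_def)
  note n = branch_bounds[OF assms]
  show ?thesis
  proof (cases "2 \<le> n j")
    case True
    then show ?thesis using branch.step[OF assms(1) d] by (auto intro: orbit_hull_base)
  next
    case False
    then obtain i' j' where "distinct3 i' j' k" "1 \<le> p i'" "1 \<le> p j'"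
      "n = p(k := p k + p i' * p j')"
      using n by blast
    moreover from this(1) have "i' = i \<and> j' = j \<or> i' = j \<and> j' = i"
      using distinct3_exhaust[OF d] by (metis distinct3_def)
    ultimately have *: "1 \<le> p i" "1 \<le> p j" "n = p(k := p k + p i * p j)"
      by (auto simp: mult.commute)
    then have pj: "p j = 1" using False ne by simp
    let ?\<sigma> = "\<lambda>x. if x = i then k else if x = k then i else x"
    have \<sigma>: "bij ?\<sigma>" by (rule involuntory_imp_bij) auto
    have t: "tmut i n = n(i := n j * n k - n i)"
      using n d by (intro tmut_cyclic) (auto intro: less_le_trans[of 0 1])
    show ?thesis
    proof (cases "p k = 0")
      case True
      have "tmut i n = (\<lambda>x. 1 * p (?\<sigma> x))"
        using ne * pj True distinct3_exhaust[OF d] unfolding t by (auto simp: fun_eq_iff)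
      moreover have "belt p p"
        using p True unfolding belt_def by (metis abs_of_nonneg less_irrefl not_less)
      ultimately show ?thesis using \<sigma> by (intro orbit_hullI[of 1 ?\<sigma>]) auto
    next
      case False
      have "tmut i n = (\<lambda>x. 1 * (p(i := p i + p j * p k)) (?\<sigma> x))"
        using ne * pj distinct3_exhaust[OF d] unfolding t by (auto simp: fun_eq_iff)
      moreover have "branch p i (p(i := p i + p j * p k))"
        using ne * False p[of k] by (intro branch.base) (auto simp: distinct3_def)
      ultimately show ?thesis using \<sigma>
        by (intro orbit_hullI[of 1 ?\<sigma> p "p(i := p i + p j * p k)"]) blast+
    qed
  qed
qed

lemma orbit_hull_tmut:
  assumes "m \<in> orbit_hull p" and "\<And>x. 0 \<le> p x"
  shows "tmut i m \<in> orbit_hull p"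
proof -
  obtain s \<sigma> n where n: "s \<in> {1, -1}" "bij \<sigma>" "belt p n \<or> (\<exists>k. branch p k n)"
    "m = (\<lambda>x. s * n (\<sigma> x))"
    using assms(1) unfolding orbit_hull_def by blast
  have "tmut (\<sigma> i) n \<in> orbit_hull p"
    using n(3) tmut_belt tmut_branch assms(2) by blast
  then show ?thesis
    unfolding n(4) tmut_equivariant[OF n(2,1)] using n(1,2) by (rule orbit_hull_equivariant)
qed

text \<open>This excludes exactly the mutation-finite classes.\<close>

definition wild :: "(3 \<Rightarrow> int) \<Rightarrow> bool" where
  "wild p \<longleftrightarrow> (\<exists>i j. i \<noteq> j \<and> 1 \<le> p i \<and> 2 \<le> p j)"

text \<open>A base over \<open>i\<close> and \<open>j\<close> with any entry at least 2 would make
  \<open>p\<close> wild. A second level would need an entry at least 2 away from \<open>k\<close>,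
  but these entries are still 1.\<close>

lemma branch_tame:
  assumes "branch p k n" and "\<not> wild p"
  shows "\<exists>i j. distinct3 i j k \<and> p i = 1 \<and> p j = 1 \<and> p k \<le> 1 \<and> n = p(k := p k + p i * p j)"
  using assms(1)
proof induction
  case (base i j k)
  then have "p i < 2" "p j < 2" "p k < 2"
    using assms(2) unfolding wild_def distinct3_def by (metis not_le)+
  then have "p i = 1" "p j = 1" "p k \<le> 1" using base by auto
  then show ?case using base by blast
next
  case (step k n i j)
  then have "n j = 1" by (smt (verit) distinct3_exhaust distinct3_def fun_upd_apply)
  then show ?case using step by simp
qed

text \<open>Only the belt and the first level of the branches are left. The bound serves to refute
  mutation-infiniteness when \<open>p\<close> is not wild.\<close>

lemma orbit_hull_tame:
  assumes "m \<in> orbit_hull p" and "\<not> wild p" and "\<And>x. 0 \<le> p x"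
  shows "\<bar>m x\<bar> \<le> 2 + sum p UNIV"
proof -
  have le: "p x \<le> sum p UNIV" for x
    using assms(3) by (intro member_le_sum) auto
  obtain s \<sigma> n where n: "s \<in> {1, -1}" "belt p n \<or> (\<exists>k. branch p k n)"
    "m = (\<lambda>x. s * n (\<sigma> x))"
    using assms(1) unfolding orbit_hull_def by blast
  have "\<bar>n y\<bar> \<le> 2 + sum p UNIV" for y
  proof (cases "belt p n")
    case True
    then show ?thesis using le[of y] by (simp add: belt_def)
  next
    case False
    then obtain k where "branch p k n" using n by blast
    then have "\<bar>n y\<bar> \<le> 2 + p y"
      using branch_tame[OF _ assms(2)] assms(3)[of y] assms(3)[of k] by fastforce
    then show ?thesis using le[of y] by simp
  qed
  then show ?thesis using n by (auto simp: abs_mult)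
qed

section \<open>Values of cluster variables at a positive point\<close>

inductive reach :: "(3 \<Rightarrow> real) \<Rightarrow> (3 \<Rightarrow> int) \<Rightarrow> (3 \<Rightarrow> real) \<Rightarrow> (3 \<Rightarrow> int) \<Rightarrow> bool"
  for v0 m0 where
  refl: "reach v0 m0 v0 m0"
| step: "reach v0 m0 v m \<Longrightarrow> reach v0 m0 (vmut i m v) (tmut i m)"

lemma reach_pos:
  assumes "reach v0 m0 v m" and "\<And>x. 0 < v0 x"
  shows "0 < v x"
  using assms(1) by (induction arbitrary: x) (auto intro: vmut_pos assms(2))

lemma reach_trans:
  assumes "reach v m v' m'" and "reach v0 m0 v m"
  shows "reach v0 m0 v' m'"
  using assms by induction (auto intro: reach.step)

text \<open>At positive values a mutation is undone by repeating it. Walks can thus be started at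
  the acyclic seed with values 1 instead of the initial seed.\<close>

lemma reach_sym:
  assumes "reach v0 m0 v m" and "\<And>x. 0 < v0 x"
  shows "reach v m v0 m0"
  using assms(1)
proof induction
  case refl
  show ?case by (rule reach.refl)
next
  case (step v m i)
  have "reach (vmut i m v) (tmut i m) v m"
    using reach.step[OF reach.refl, of "vmut i m v" "tmut i m" i]
      vmut_vmut[of v i m] reach_pos[OF step(1) assms(2)] by simp
  then show ?case using step.IH by (rule reach_trans[rotated])
qed

lemma reach_orbit_hull:
  assumes "reach v0 m0 v m" and "belt p m0" and "\<And>x. 0 \<le> p x"
  shows "m \<in> orbit_hull p"
  using assms(1)
proof induction
  case refl
  show ?case using assms(2) by (simp add: orbit_hull_base)
next
  case (step v m i)
  show ?case using step.IH assms(3) by (rule orbit_hull_tmut)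
qed

lemma reach_flip:
  assumes "reach v0 m0 v m" and "distinct3 i j k" and "m j * m k \<le> 0"
  shows "reach v0 m0 (v(i := (1 + v j ^ nat \<bar>m k\<bar> * v k ^ nat \<bar>m j\<bar>) / v i)) (m(i := - m i))"
  using reach.step[OF assms(1), of i] assms(3) by (simp add: tmut_eq[OF assms(2)] vmut_eq[OF assms(2)])

lemma reach_cyclic:
  assumes "reach v0 m0 v m" and "distinct3 i j k" and "0 < m j * m k"
  shows "reach v0 m0 (v(i := (v j ^ nat \<bar>m k\<bar> + v k ^ nat \<bar>m j\<bar>) / v i))
    (m(i := - m i + sgn (m j) * (m j * m k)))"
  using reach.step[OF assms(1), of i] assms(3) by (simp add: tmut_eq[OF assms(2)] vmut_eq[OF assms(2)])

text \<open>Both signs are demanded because the degrees \<open>d\<close> and \<open>-d\<close> have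
  to be served alike; the maximality of \<open>v k\<close> is what carries the growth to the next
  step.\<close>

definition large :: "(3 \<Rightarrow> int) \<Rightarrow> 3 \<Rightarrow> (3 \<Rightarrow> int) \<Rightarrow> bool" where
  "large m0 k n \<longleftrightarrow> (\<forall>M. \<forall>s \<in> {1, -1}. \<exists>v. reach (\<lambda>_. 1) m0 v (\<lambda>x. s * n x)
      \<and> (\<forall>x. M \<le> v x \<and> v x \<le> v k))"

text \<open>The exchange relation gives \<open>v\<^sub>i' \<ge> v\<^sub>k\<^sup>2 / v\<^sub>i \<ge> v\<^sub>k\<close> as soon as \<open>v\<^sub>k\<close> occurs with exponent at
  least 2 and is the largest value.\<close>

lemma exchange_ge:
  fixes a b c :: real
  assumes "0 < c" "c \<le> a" "1 \<le> a" "0 \<le> b" "2 \<le> e"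
  shows "a \<le> (b + a ^ e) / c"
proof -
  have "a * c \<le> a * a" using assms by (intro mult_left_mono) auto
  also have "\<dots> \<le> a ^ e" using assms power_increasing[of 2 e a] by (simp add: power2_eq_square)
  also have "\<dots> \<le> b + a ^ e" using assms by simp
  finally show ?thesis using assms by (simp add: pos_le_divide_eq)
qed

lemma large_step:
  assumes "large m0 k n" and "\<And>x. 1 \<le> n x" and "distinct3 i j k" and "2 \<le> n j"
  shows "large m0 i (tmut i n)"
  unfolding large_def
proof (intro allI ballI)
  fix M :: real and s :: int
  assume s: "s \<in> {1, -1}"
  obtain v where v: "reach (\<lambda>_. 1) m0 v (\<lambda>x. s * n x)" "\<And>x. max M 1 \<le> v x" "\<And>x. v x \<le> v k"
    using assms(1) s unfolding large_def by blast
  have n: "1 \<le> n i" "1 \<le> n j" "1 \<le> n k" using assms(2) by auto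
  have v1: "1 \<le> v x" for x using v(2)[of x] by simp
  define w where "w = vmut i (\<lambda>x. s * n x) v"
  have pos: "0 < (s * n j) * (s * n k)" using s n by (auto simp: mult_neg_neg)
  have "reach (\<lambda>_. 1) m0 w (\<lambda>x. s * tmut i n x)"
    using reach.step[OF v(1), of i] tmut_equivariant[OF bij_id s, of i n] by (simp add: w_def)
  moreover have "w = v(i := (v j ^ nat (n k) + v k ^ nat (n j)) / v i)"
    using pos s n by (auto simp: w_def vmut_eq[OF assms(3)])
  moreover have "v k \<le> (v j ^ nat (n k) + v k ^ nat (n j)) / v i"
    using v(3)[of i] v1[of i] v1[of k] v1[of j] assms(4)
    by (intro exchange_ge) auto
  ultimately have "reach (\<lambda>_. 1) m0 w (\<lambda>x. s * tmut i n x)" "v k \<le> w i" "\<And>x. x \<noteq> i \<Longrightarrow> w x = v x"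
    by auto
  moreover have "M \<le> v x" for x using v(2)[of x] by simp
  ultimately show "\<exists>v. reach (\<lambda>_. 1) m0 v (\<lambda>x. s * tmut i n x) \<and> (\<forall>x. M \<le> v x \<and> v x \<le> v i)"
    using v(3) by (intro exI[of _ w]) (metis order_refl order_trans)
qed

text \<open>The signs of an acyclic quiver in which \<open>k\<close> is neither a source nor a sink.\<close>

definition mid :: "(3 \<Rightarrow> int) \<Rightarrow> 3 \<Rightarrow> int \<Rightarrow> 3 \<Rightarrow> int" where
  "mid p k s = (\<lambda>x. if x = k then - s * p x else s * p x)"

section \<open>Growth along the belt without a vanishing entry\<close>

definition ascending :: "(3 \<Rightarrow> int) \<Rightarrow> (3 \<Rightarrow> int) \<Rightarrow> real \<Rightarrow> 3 \<Rightarrow> 3 \<Rightarrow> 3 \<Rightarrow> int \<Rightarrow> bool" where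
  "ascending m0 p M k i j s \<longleftrightarrow> (\<exists>v. reach (\<lambda>_. 1) m0 v (mid p k s) \<and>
     M \<le> v j \<and> 3/2 * v j \<le> v k \<and> 3/2 * v k \<le> v i)"

lemma ascendingI:
  assumes "reach (\<lambda>_. 1) m0 v (mid p k s)" "M \<le> v j" "3/2 * v j \<le> v k" "3/2 * v k \<le> v i"
  shows "ascending m0 p M k i j s"
  using assms unfolding ascending_def by blast

lemma mid_flip:
  assumes "distinct3 k i j"
  shows "(mid p k s)(j := - mid p k s j) = mid p i (- s)"
  using assms distinct3_exhaust[OF assms] by (auto simp: mid_def fun_eq_iff distinct3_def)

text \<open>The vertex \<open>j\<close> is a source or a sink, and all exponents are at least 1, so
  its new value is at least \<open>v k * v i / v j\<close>, hence at least \<open>3/2 * v i\<close>.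
  The least value has become the greatest, and the roles rotate.\<close>

lemma ascending_rot:
  assumes "ascending m0 p M k i j s" "1 \<le> M" "\<And>x. 1 \<le> p x" "distinct3 k i j" "s \<in> {1, -1}"
  shows "ascending m0 p (3/2 * M) i j k (- s)"
proof -
  obtain v where v: "reach (\<lambda>_. 1) m0 v (mid p k s)" "M \<le> v j" "3/2 * v j \<le> v k" "3/2 * v k \<le> v i"
    using assms(1) unfolding ascending_def by blast
  have ge: "1 \<le> v j" "1 \<le> v k" "1 \<le> v i" using v assms(2) by linarith+
  have ne: "k \<noteq> i" "k \<noteq> j" "i \<noteq> j" and p: "1 \<le> p k" "1 \<le> p i" using assms by (auto simp: distinct3_def)
  have d: "distinct3 j k i" using assms(4) by (auto simp: distinct3_def)
  have abs: "\<bar>mid p k s x\<bar> = p x" for x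
    using assms(5) assms(3)[of x] by (auto simp: mid_def abs_mult)
  have "mid p k s k * mid p k s i \<le> 0" using ne p assms(5) by (auto simp: mid_def)
  from reach_flip[OF v(1) d this]
  have r: "reach (\<lambda>_. 1) m0 (v(j := (1 + v k ^ nat (p i) * v i ^ nat (p k)) / v j)) (mid p i (- s))"
    using mid_flip[OF assms(4)] by (simp add: abs)
  have "3/2 * v i * v j \<le> v k * v i"
    using mult_left_mono[OF v(3), of "v i"] ge by (simp add: ac_simps)
  also have "\<dots> \<le> v k ^ nat (p i) * v i ^ nat (p k)"
    using ge p by (intro mult_mono self_le_power) auto
  finally have "3/2 * v i \<le> (1 + v k ^ nat (p i) * v i ^ nat (p k)) / v j"
    using ge by (simp add: pos_le_divide_eq)
  then show ?thesis
    using v ne by (intro ascendingI[OF r]) auto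
qed

lemma ascending_mono: "ascending m0 p M k i j s \<Longrightarrow> M' \<le> M \<Longrightarrow> ascending m0 p M' k i j s"
  unfolding ascending_def by force

text \<open>Three rotations return to \<open>k\<close>, reverse the sign and multiply the bound by
  27/8, of which a factor 2 is kept. Both signs are therefore carried through the induction.\<close>

lemma ascending_unbounded:
  assumes "ascending m0 p 1 k i j s" "\<And>x. 1 \<le> p x" "distinct3 k i j" "s \<in> {1, -1}" "s' \<in> {1, -1}"
  shows "ascending m0 p M k i j s'"
proof -
  have d: "distinct3 i j k" "distinct3 j k i" using assms(3) by (auto simp: distinct3_def)
  have rot3: "ascending m0 p (2 * M) k i j (- s)"
    if "ascending m0 p M k i j s" "1 \<le> M" "s \<in> {1, -1}" for M s
  proof -
    have "ascending m0 p (3/2 * M) i j k (- s)"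
      using ascending_rot[OF that(1,2) assms(2,3)] that(3) by blast
    then have "ascending m0 p (3/2 * (3/2 * M)) j k i (- (- s))"
      using that(2,3) by (intro ascending_rot[OF _ _ assms(2) d(1)]) auto
    then have "ascending m0 p (3/2 * (3/2 * (3/2 * M))) k i j (- (- (- s)))"
      using that(2,3) by (intro ascending_rot[OF _ _ assms(2) d(2)]) auto
    then show ?thesis using that(2) by (auto elim: ascending_mono)
  qed
  have "ascending m0 p (2 ^ n) k i j s \<and> ascending m0 p (2 ^ n) k i j (- s)" for n
  proof (induction n)
    case 0
    then show ?case using assms(1) rot3[OF assms(1) _ assms(4)] by (auto elim: ascending_mono)
  next
    case (Suc n)
    then show ?case using rot3[of "2 ^ n" s] rot3[of "2 ^ n" "- s"] assms(4) by auto
  qed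
  moreover obtain n where "M < 2 ^ n" using real_arch_pow[of 2 M] by auto
  ultimately show ?thesis
    using assms(4,5) ascending_mono[of m0 p "2 ^ n" k i j s' M] by (auto simp: less_imp_le)
qed

text \<open>Flipping \<open>j\<close>, \<open>k\<close> and \<open>i\<close> in turn takes the
  values 1 to those displayed in step 3. The ratio 3/2 is attained by the first two, 2 and 3, when
  \<open>p i = 1\<close>.\<close>

lemma ascending_initial:
  assumes "\<And>x. 1 \<le> p x" "distinct3 k i j" "s \<in> {1, -1}"
  shows "ascending (mid p k s) p 1 k i j (- s)"
proof -
  have ne: "k \<noteq> i" "k \<noteq> j" "i \<noteq> j" "i \<noteq> k" "j \<noteq> k" "j \<noteq> i" using assms by (auto simp: distinct3_def)
  have d: "distinct3 j k i" "distinct3 k i j" "distinct3 i j k" using assms(2) by (auto simp: distinct3_def)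
  have p: "1 \<le> p k" "1 \<le> p i" "1 \<le> p j" using assms by auto
  have abs: "\<bar>mid p k s x\<bar> = p x" if "s \<in> {1, -1}" for k s x
    using that assms(1)[of x] by (auto simp: mid_def abs_mult)
  have s': "- s \<in> {1, -1}" using assms(3) by auto
  have "mid p k s k * mid p k s i \<le> 0" using ne p assms(3) by (auto simp: mid_def)
  from reach_flip[OF reach.refl[of "\<lambda>_. 1"] d(1) this] mid_flip[OF d(2)]
  have 1: "reach (\<lambda>_. 1) (mid p k s) ((\<lambda>_. 1)(j := 2)) (mid p i (- s))" by simp
  have "mid p i (- s) i * mid p i (- s) j \<le> 0" using ne p assms(3) by (auto simp: mid_def)
  from reach_flip[OF 1 d(2) this] mid_flip[OF d(3), of p "- s"]
  have 2: "reach (\<lambda>_. 1) (mid p k s) ((\<lambda>_. 1)(j := 2, k := 1 + 2 ^ nat (p i))) (mid p j s)"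
    using ne by (simp add: abs[OF s'])
  have "mid p j s j * mid p j s k \<le> 0" using ne p assms(3) by (auto simp: mid_def)
  from reach_flip[OF 2 d(3) this] mid_flip[OF d(1), of p s]
  have 3: "reach (\<lambda>_. 1) (mid p k s) ((\<lambda>_. 1)(j := 2, k := 1 + 2 ^ nat (p i),
      i := 1 + 2 ^ nat (p k) * (1 + 2 ^ nat (p i)) ^ nat (p j))) (mid p k (- s))"
    using ne by (simp add: abs[OF assms(3)])
  have "(2 :: real) \<le> 2 ^ nat (p i)" "(2 :: real) \<le> 2 ^ nat (p k)"
    using p by (auto intro: self_le_power)
  moreover have "1 + 2 ^ nat (p i) \<le> (1 + 2 ^ nat (p i) :: real) ^ nat (p j)"
    using p by (intro self_le_power) auto
  then have "2 * (1 + 2 ^ nat (p i)) \<le> (2 :: real) ^ nat (p k) * (1 + 2 ^ nat (p i)) ^ nat (p j)"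
    using \<open>2 \<le> 2 ^ nat (p k)\<close> by (intro mult_mono) auto
  ultimately show ?thesis
    using ne by (intro ascendingI[OF 3]) auto
qed

text \<open>Of three nonzero entries whose signs are not all equal, exactly one has the minority
  sign; its index is \<open>k\<close>.\<close>

lemma belt_eq_mid:
  assumes "belt p m" "\<And>x. 1 \<le> p x"
  obtains k s where "s \<in> {1, -1}" "m = mid p k s"
proof -
  have abs: "\<bar>m x\<bar> = p x" for x using assms(1) by (simp add: belt_def)
  have pos: "0 < p x" for x using assms(2)[of x] by simp
  have sg: "m x = p x \<or> m x = - p x" for x using abs[of x] by auto
  have d: "distinct3 1 2 3" by (simp add: distinct3_def)
  have mixed: "\<not> (m 1 = p 1 \<and> m 2 = p 2 \<and> m 3 = p 3)"
    "\<not> (m 1 = - p 1 \<and> m 2 = - p 2 \<and> m 3 = - p 3)"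
    using assms(1) pos[of 1] pos[of 2] pos[of 3] unfolding belt_def distinct3_all[OF d] by auto
  have eq: "m = mid p k s"
    if "m 1 = mid p k s 1" "m 2 = mid p k s 2" "m 3 = mid p k s 3" for k s
    using that unfolding fun_eq_iff distinct3_all[OF d] by blast
  show ?thesis
    using sg[of 1] sg[of 2] sg[of 3]
  proof (elim disjE, goal_cases)
    case 1
    then show ?thesis using mixed by blast
  next
    case 2
    then show ?thesis by (intro that[of "1" 3] eq) (simp_all add: mid_def)
  next
    case 3
    then show ?thesis by (intro that[of "1" 2] eq) (simp_all add: mid_def)
  next
    case 4
    then show ?thesis by (intro that[of "-1" 1] eq) (simp_all add: mid_def)
  next
    case 5
    then show ?thesis by (intro that[of "1" 1] eq) (simp_all add: mid_def)
  next
    case 6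
    then show ?thesis by (intro that[of "-1" 2] eq) (simp_all add: mid_def)
  next
    case 7
    then show ?thesis by (intro that[of "-1" 3] eq) (simp_all add: mid_def)
  next
    case 8
    then show ?thesis using mixed by blast
  qed
qed

text \<open>The order of \<open>k\<close>, \<open>i\<close>, \<open>j\<close> selects the direction
  in which the belt is followed; at most two more rotations then move the middle vertex from
  \<open>k0\<close> to \<open>k\<close>.\<close>

lemma mid_unbounded_pos:
  assumes "belt p m0" "\<And>x. 1 \<le> p x" "distinct3 k i j" "s \<in> {1, -1}"
  shows "ascending m0 p M k i j s"
proof -
  obtain k0 s0 where m0: "s0 \<in> {1, -1}" "m0 = mid p k0 s0"
    using belt_eq_mid[OF assms(1,2)] by blast
  have d: "distinct3 i j k" "distinct3 j k i" using assms(3) by (auto simp: distinct3_def)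
  have start: "ascending m0 p M k0 a b t" if "distinct3 k0 a b" "t \<in> {1, -1}" for a b M t
    using ascending_unbounded[OF ascending_initial[OF assms(2) that(1) m0(1)] assms(2) that(1)] that m0
    by auto
  have rot: "ascending m0 p M b c a t"
    if "\<And>M t. t \<in> {1, -1} \<Longrightarrow> ascending m0 p M a b c t" "distinct3 a b c" "t \<in> {1, -1}" for a b c M t
  proof -
    have "ascending m0 p (3/2 * max M 1) b c a (- (- t))"
      using that(3) by (intro ascending_rot[OF that(1) _ assms(2) that(2)]) auto
    moreover have "M \<le> 3/2 * max M 1" by simp
    ultimately show ?thesis using ascending_mono by simp
  qed
  consider "k0 = k" | "k0 = i" | "k0 = j" using distinct3_exhaust[OF assms(3)] by blast
  then show ?thesis
  proof cases
    case 1
    then show ?thesis using start assms(3,4) by blast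
  next
    case 2
    then have "ascending m0 p M j k i t" if "t \<in> {1, -1}" for M t
      using rot[of i j k] start d that by blast
    then show ?thesis using rot[of j k i] d assms(4) by blast
  next
    case 3
    then show ?thesis using rot[of j k i] start d assms(4) by blast
  qed
qed

section \<open>Growth along the belt with a vanishing entry\<close>

text \<open>For \<open>p k = 0\<close> and these signs the quiver is bipartite, with \<open>k\<close> a source or a sink.\<close>

definition opposed :: "(3 \<Rightarrow> int) \<Rightarrow> 3 \<Rightarrow> 3 \<Rightarrow> int \<Rightarrow> 3 \<Rightarrow> int" where
  "opposed p i j s = (\<lambda>x. if x = i then s * p x else if x = j then - s * p x else 0)"

text \<open>No arrow joins \<open>i\<close> and \<open>j\<close>, so their new values involve
  \<open>c\<close> but not each other. The stop after two flips is recorded because there the belt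
  can be left at \<open>k\<close>.\<close>

lemma opposed_sweep:
  assumes r: "reach v0 m0 v (opposed p i j s)" and d: "distinct3 k i j"
    and p: "p k = 0" "0 \<le> p i" "0 \<le> p j" and s: "s \<in> {1, -1}"
  defines "c \<equiv> (1 + v i ^ nat (p j) * v j ^ nat (p i)) / v k"
  defines "a \<equiv> (1 + c ^ nat (p j)) / v i"
  defines "b \<equiv> (1 + c ^ nat (p i)) / v j"
  shows "reach v0 m0 (v(k := c, i := a)) (mid p k (- s))"
    and "reach v0 m0 (v(k := c, i := a, j := b)) (opposed p i j (- s))"
proof -
  have ne: "k \<noteq> i" "k \<noteq> j" "i \<noteq> j" "i \<noteq> k" "j \<noteq> k" "j \<noteq> i" using d by (auto simp: distinct3_def)
  have d': "distinct3 i k j" "distinct3 j k i" using d by (auto simp: distinct3_def)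
  note ext3 = distinct3_all[OF d]
  have 1: "reach v0 m0 (v(k := c)) (opposed p i j s)"
  proof -
    have "(opposed p i j s)(k := - opposed p i j s k) = opposed p i j s"
      using ne unfolding fun_eq_iff ext3 by (simp add: opposed_def)
    then show ?thesis
      using reach_flip[OF r d] s ne p by (auto simp: opposed_def abs_mult c_def)
  qed
  have "(opposed p i j s)(i := - opposed p i j s i) = mid p k (- s)"
    using ne p unfolding fun_eq_iff ext3 by (simp add: opposed_def mid_def)
  then show 2: "reach v0 m0 (v(k := c, i := a)) (mid p k (- s))"
    using reach_flip[OF 1 d'(1)] s ne p by (auto simp: opposed_def abs_mult a_def)
  have "(mid p k (- s))(j := - mid p k (- s) j) = opposed p i j (- s)"
    using ne p unfolding fun_eq_iff ext3 by (simp add: opposed_def mid_def)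
  then show "reach v0 m0 (v(k := c, i := a, j := b)) (opposed p i j (- s))"
    using reach_flip[OF 2 d'(2)] s ne p by (auto simp: mid_def abs_mult b_def)
qed

text \<open>The lower bounds on \<open>v j\<close> are those that are preserved by a sweep over the bipartite quiver.\<close>

definition swing :: "(3 \<Rightarrow> int) \<Rightarrow> (3 \<Rightarrow> int) \<Rightarrow> real \<Rightarrow> 3 \<Rightarrow> 3 \<Rightarrow> 3 \<Rightarrow> int \<Rightarrow> bool" where
  "swing m0 p G k i j s \<longleftrightarrow> (\<exists>v. reach (\<lambda>_. 1) m0 v (opposed p i j s) \<and>
     G \<le> v k \<and> v k \<le> v i \<and> 2 \<le> v j \<and> G \<le> 2 * v j)"

text \<open>As \<open>p j\<close> is at least 2 and \<open>v i\<close> at least \<open>v k\<close>,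
  the value \<open>c\<close> is at least \<open>v i * v j\<close>, hence at least
  \<open>2 * v i\<close>. Then \<open>a\<close> is at least \<open>c\<close> by
  \<open>exchange_ge\<close>, and \<open>b\<close> at least \<open>v i\<close>: the value at
  \<open>j\<close> lags by a factor 2.\<close>

lemma swing_step:
  assumes "swing m0 p G k i j s" "2 \<le> G" "distinct3 k i j"
    and p: "p k = 0" "1 \<le> p i" "2 \<le> p j" and s: "s \<in> {1, -1}"
  shows "swing m0 p (2 * G) k i j (- s)"
    and "\<exists>v. reach (\<lambda>_. 1) m0 v (mid p k (- s)) \<and> G \<le> 2 * v j \<and> v j \<le> v k \<and> v k \<le> v i"
proof -
  obtain v where v: "reach (\<lambda>_. 1) m0 v (opposed p i j s)"
    "G \<le> v k" "v k \<le> v i" "2 \<le> v j" "G \<le> 2 * v j"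
    using assms(1) unfolding swing_def by blast
  have ne: "k \<noteq> i" "k \<noteq> j" "i \<noteq> j" "i \<noteq> k" "j \<noteq> k" "j \<noteq> i"
    using assms(3) by (auto simp: distinct3_def)
  define c where "c = (1 + v i ^ nat (p j) * v j ^ nat (p i)) / v k"
  define a where "a = (1 + c ^ nat (p j)) / v i"
  define b where "b = (1 + c ^ nat (p i)) / v j"
  have p': "0 \<le> p i" "0 \<le> p j" using p by auto
  note sweep = opposed_sweep[OF v(1) assms(3) p(1) p' s, folded c_def, folded a_def b_def]
  have ge: "1 \<le> v i" "1 \<le> v j" "2 \<le> v k" using v assms(2) by linarith+
  have "(v i * v j) * v k \<le> (v i * v j) * v i" using v ge by (intro mult_left_mono) auto
  also have "\<dots> = v i ^ 2 * v j" by (simp add: power2_eq_square)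
  also have "\<dots> \<le> v i ^ nat (p j) * v j ^ nat (p i)"
    using ge p by (intro mult_mono self_le_power power_increasing) auto
  finally have c: "v i * v j \<le> c" using ge by (simp add: c_def pos_le_divide_eq)
  have "v i * 2 \<le> v i * v j" "1 * v j \<le> v i * v j"
    using ge v by (intro mult_left_mono mult_right_mono; simp)+
  with c have c2: "2 * v i \<le> c" "v j \<le> c" by linarith+
  have a: "c \<le> a" unfolding a_def using ge c2 p by (intro exchange_ge) auto
  have "v i * v j \<le> c ^ nat (p i)"
    using c c2 ge p self_le_power[of c "nat (p i)"] by auto
  then have b: "v i \<le> b" using ge by (simp add: b_def pos_le_divide_eq)
  show "swing m0 p (2 * G) k i j (- s)"
    unfolding swing_def using sweep(2) ne a b c2 v ge
    by (intro exI[of _ "v(k := c, i := a, j := b)"]) auto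
  show "\<exists>v. reach (\<lambda>_. 1) m0 v (mid p k (- s)) \<and> G \<le> 2 * v j \<and> v j \<le> v k \<and> v k \<le> v i"
    using sweep(1) ne a c2 v ge by (intro exI[of _ "v(k := c, i := a)"]) auto
qed

text \<open>The range of \<open>v i\<close> covers both possible starts: the value is 1 if
  \<open>m0\<close> already has opposed signs, and 2 if \<open>i\<close> has to be flipped
  first.\<close>

lemma swing_initial:
  assumes "reach (\<lambda>_. 1) m0 v (opposed p i j s)" and v: "v k = 1" "v j = 1" "1 \<le> v i" "v i \<le> 2"
    and "distinct3 k i j" and p: "p k = 0" "1 \<le> p i" "2 \<le> p j" and s: "s \<in> {1, -1}"
  shows "swing m0 p 2 k i j (- s)"
proof -
  have ne: "k \<noteq> i" "k \<noteq> j" "i \<noteq> j" "i \<noteq> k" "j \<noteq> k" "j \<noteq> i"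
    using assms(6) by (auto simp: distinct3_def)
  define c where "c = (1 + v i ^ nat (p j) * v j ^ nat (p i)) / v k"
  define a where "a = (1 + c ^ nat (p j)) / v i"
  define b where "b = (1 + c ^ nat (p i)) / v j"
  have p': "0 \<le> p i" "0 \<le> p j" using p by auto
  note sweep = opposed_sweep[OF assms(1,6) p(1) p' s, folded c_def, folded a_def b_def]
  have "1 \<le> v i ^ nat (p j)" using v by (intro one_le_power) auto
  then have c: "2 \<le> c" using v by (simp add: c_def)
  then have a: "c \<le> a" unfolding a_def using v p by (intro exchange_ge) auto
  have "c \<le> c ^ nat (p i)" using c p by (intro self_le_power) auto
  then have b: "2 \<le> b" using c v by (simp add: b_def)
  show ?thesis
    unfolding swing_def using sweep(2) ne a b c
    by (intro exI[of _ "v(k := c, i := a, j := b)"]) auto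
qed

lemma mid_unbounded_zero:
  assumes "belt p m0" "distinct3 k i j" and p: "p k = 0" "1 \<le> p i" "2 \<le> p j" and s: "s \<in> {1, -1}"
  shows "\<exists>v. reach (\<lambda>_. 1) m0 v (mid p k s) \<and> M \<le> v j \<and> v j \<le> v k \<and> v k \<le> v i"
proof -
  note d = assms(2)
  have ne: "k \<noteq> i" "k \<noteq> j" "i \<noteq> j" "i \<noteq> k" "j \<noteq> k" "j \<noteq> i"
    using d by (auto simp: distinct3_def)
  have abs: "\<bar>m0 x\<bar> = p x" for x using assms(1) by (simp add: belt_def)
  define t where "t = sgn (m0 j)"
  have t: "t \<in> {1, -1}" "m0 j = t * p j" "m0 k = 0"
    using abs[of j] abs[of k] p unfolding t_def by (auto simp: sgn_if)
  have "\<exists>s \<in> {1, -1}. swing m0 p 2 k i j s"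
  proof (cases "m0 i = - (t * p i)")
    case True
    then have "m0 = opposed p i j (- t)"
      using ne t unfolding fun_eq_iff distinct3_all[OF d] by (simp add: opposed_def)
    then have "swing m0 p 2 k i j (- (- t))"
      using t d p reach.refl[of "\<lambda>_. 1" m0] by (intro swing_initial) auto
    then show ?thesis using t by auto
  next
    case False
    then have "m0 i = t * p i" using abs[of i] t by (auto simp: abs_if split: if_splits)
    then have "m0(i := - m0 i) = opposed p i j (- t)"
      using ne t unfolding fun_eq_iff distinct3_all[OF d] by (simp add: opposed_def)
    then have r: "reach (\<lambda>_. 1) m0 ((\<lambda>_. 1)(i := 2)) (opposed p i j (- t))"
      using reach_flip[OF reach.refl[of "\<lambda>_. 1" m0], of i k j] d t by (auto simp: distinct3_def)
    have "swing m0 p 2 k i j (- (- t))"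
      using t d p ne by (intro swing_initial[OF r]) auto
    then show ?thesis using t by auto
  qed
  then obtain s0 where s0: "s0 \<in> {1, -1}" "swing m0 p 2 k i j s0" by blast
  \<comment> \<open>Each sweep reverses the sign, so the bound for \<open>u\<close> comes from the
    one for \<open>- u\<close>; the start therefore has to supply both signs.\<close>
  have grow: "\<exists>G \<ge> 2 ^ n. 2 \<le> G \<and> swing m0 p G k i j u" if "u \<in> {1, -1}" for n u
    using that
  proof (induction n arbitrary: u)
    case 0
    have "swing m0 p (2 * 2) k i j (- s0)" using s0 d p by (intro swing_step(1)) auto
    moreover have "u = s0 \<or> u = - s0" using 0 s0(1) by auto
    ultimately show ?case using s0(2)
      by (elim disjE) (auto intro: exI[of _ "2 :: real"] exI[of _ "4 :: real"])
  next
    case (Suc n)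
    obtain G where "2 ^ n \<le> G" "2 \<le> G" "swing m0 p G k i j (- u)"
      using Suc.IH[of "- u"] Suc.prems by auto
    then show ?case
      using swing_step(1)[of m0 p G k i j "- u"] d p Suc.prems by (intro exI[of _ "2 * G"]) auto
  qed
  \<comment> \<open>The factor 2 makes up for the lag in \<open>G \<le> 2 * v j\<close>.\<close>
  obtain n where n: "2 * M < 2 ^ n" using real_arch_pow[of 2 "2 * M"] by auto
  obtain G where "2 ^ n \<le> G" "2 \<le> G" "swing m0 p G k i j (- s)"
    using grow[of "- s" n] s by auto
  then obtain v where "reach (\<lambda>_. 1) m0 v (mid p k s)" "G \<le> 2 * v j" "v j \<le> v k" "v k \<le> v i"
    using swing_step(2)[of m0 p G k i j "- s"] d p s by auto
  moreover from this have "M \<le> v j" using \<open>2 ^ n \<le> G\<close> n by linarith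
  ultimately show ?thesis by blast
qed

section \<open>Growth after leaving the belt\<close>

lemma mid_unbounded:
  assumes "belt p m0" "distinct3 k i j" "1 \<le> p i" "2 \<le> p j" "s \<in> {1, -1}"
  shows "\<exists>v. reach (\<lambda>_. 1) m0 v (mid p k s) \<and> M \<le> v j \<and> v j \<le> v k \<and> v k \<le> v i"
proof (cases "p k = 0")
  case True
  then show ?thesis using mid_unbounded_zero assms by blast
next
  case False
  then have "1 \<le> p k" using assms(1) unfolding belt_def by (smt (verit))
  then have "\<forall>x. 1 \<le> p x" using assms(3,4) unfolding distinct3_all[OF assms(2)] by auto
  then have "ascending m0 p (max M 0) k i j s"
    using mid_unbounded_pos[OF assms(1) _ assms(2,5)] by blast
  then obtain v where "reach (\<lambda>_. 1) m0 v (mid p k s)" "max M 0 \<le> v j"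
    "3/2 * v j \<le> v k" "3/2 * v k \<le> v i"
    unfolding ascending_def by blast
  then show ?thesis by (intro exI[of _ v]) auto
qed

text \<open>The belt is left at \<open>k\<close> at a moment when \<open>v i\<close> is the largest
  value. It enters the exchange relation with exponent \<open>p j\<close>, at least 2, so
  \<open>exchange_ge\<close> applies.\<close>

lemma large_child:
  assumes "belt p m0" "distinct3 k i j" "1 \<le> p i" "2 \<le> p j"
  shows "large m0 k (p(k := p k + p i * p j))"
  unfolding large_def
proof (intro allI ballI)
  fix M :: real and s :: int
  assume s: "s \<in> {1, -1}"
  obtain v where v: "reach (\<lambda>_. 1) m0 v (mid p k s)" "max M 1 \<le> v j" "v j \<le> v k" "v k \<le> v i"
    using mid_unbounded[OF assms s] by blast
  have ne: "k \<noteq> i" "k \<noteq> j" "i \<noteq> j" "i \<noteq> k" "j \<noteq> k" "j \<noteq> i"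
    using assms(2) by (auto simp: distinct3_def)
  have d: "distinct3 k j i" using assms(2) by (auto simp: distinct3_def)
  have mj: "mid p k s j = s * p j" "mid p k s i = s * p i" "mid p k s k = - s * p k"
    using ne by (auto simp: mid_def)
  have pos: "0 < mid p k s j * mid p k s i"
    using s assms(3,4) unfolding mj by auto
  define w where "w = v(k := (v j ^ nat (p i) + v i ^ nat (p j)) / v k)"
  have "(mid p k s)(k := - mid p k s k + sgn (mid p k s j) * (mid p k s j * mid p k s i))
      = (\<lambda>x. s * (p(k := p k + p i * p j)) x)"
    using s assms(3,4) ne unfolding fun_eq_iff distinct3_all[OF assms(2)]
    by (auto simp: mid_def sgn_mult)
  moreover have "\<bar>mid p k s j\<bar> = p j" "\<bar>mid p k s i\<bar> = p i"
    using s assms(3,4) unfolding mj by (auto simp: abs_mult)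
  ultimately have "reach (\<lambda>_. 1) m0 w (\<lambda>x. s * (p(k := p k + p i * p j)) x)"
    using reach_cyclic[OF v(1) d pos] by (simp add: w_def)
  moreover have "v i \<le> w k"
    unfolding w_def using v assms(4) by (auto intro!: exchange_ge)
  then have "\<forall>x. M \<le> w x \<and> w x \<le> w k"
    using v ne unfolding distinct3_all[OF assms(2)] by (auto simp: w_def)
  ultimately show "\<exists>v. reach (\<lambda>_. 1) m0 v (\<lambda>x. s * (p(k := p k + p i * p j)) x)
      \<and> (\<forall>x. M \<le> v x \<and> v x \<le> v k)"
    by blast
qed

lemma large_branch:
  assumes "branch p k n" "belt p m0"
  shows "large m0 k n \<or> (\<exists>i j. distinct3 i j k \<and> p i = 1 \<and> p j = 1 \<and> n = p(k := p k + p i * p j))"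
  using assms(1)
proof induction
  case (base i j k)
  have d: "distinct3 k i j" "distinct3 k j i" using base(1) by (auto simp: distinct3_def)
  consider "p i = 1" "p j = 1" | "2 \<le> p j" | "2 \<le> p i" using base by linarith
  then show ?case
  proof cases
    case 1
    then show ?thesis using base(1) by blast
  next
    case 2
    then show ?thesis using large_child[OF assms(2) d(1)] base by blast
  next
    case 3
    then show ?thesis using large_child[OF assms(2) d(2)] base by (metis mult.commute)
  qed
next
  case (step k n i j)
  have p: "\<And>x. 0 \<le> p x" using assms(2) by (metis abs_ge_zero belt_def)
  \<comment> \<open>The exceptional alternative is impossible: away from \<open>k\<close> its
    entries are 1, whereas \<open>n j\<close> is at least 2.\<close>
  have "large m0 k n"
    using step.IH step.hyps(2,3) by (smt (verit) distinct3_def distinct3_exhaust fun_upd_apply)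
  moreover have "\<And>x. 1 \<le> n x" using branch_bounds[OF step.hyps(1) p] by blast
  ultimately show ?case using large_step step.hyps(2,3) by blast
qed

text \<open>The index \<open>i'\<close> is free, so it suffices to find the entry up to permutation:
  on the belt or in a large triple, with either sign. Only the newest entry over two edges of
  multiplicity 1 needs another source.\<close>

lemma reach_unbounded:
  assumes "belt p m0" "wild p" "reach (\<lambda>_. 1) m0 v m" "e \<in> {1, -1}"
  shows "\<exists>v' m' i'. reach (\<lambda>_. 1) m0 v' m' \<and> m' i' = e * m i \<and> M \<le> v' i'"
proof -
  have p: "0 \<le> p x" for x using assms(1) by (metis abs_ge_zero belt_def)
  have belt_entry: "\<exists>v' m' i'. reach (\<lambda>_. 1) m0 v' m' \<and> m' i' = u * p y \<and> M \<le> v' i'"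
    if "u \<in> {1, -1}" for u y
  proof -
    obtain a b where ab: "a \<noteq> b" "1 \<le> p a" "2 \<le> p b" using assms(2) unfolding wild_def by blast
    then obtain c where "distinct3 a c b" using distinct3_third by blast
    then have d: "distinct3 c a b" by (auto simp: distinct3_def)
    \<comment> \<open>\<open>mid\<close> reverses the sign at its middle vertex
      \<open>c\<close>.\<close>
    define s where "s = (if y = c then - u else u)"
    have s: "s \<in> {1, -1}" "mid p c s y = u * p y"
      using that by (auto simp: mid_def s_def)
    obtain v where v: "reach (\<lambda>_. 1) m0 v (mid p c s)" "M \<le> v b" "v b \<le> v c" "v c \<le> v a"
      using mid_unbounded[OF assms(1) d ab(2,3) s(1)] by blast
    have "M \<le> v y" using v distinct3_exhaust[OF d, of y] by auto
    then show ?thesis using v(1) s(2) by blast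
  qed
  have large_entry: "\<exists>v' m' i'. reach (\<lambda>_. 1) m0 v' m' \<and> m' i' = u * n y \<and> M \<le> v' i'"
    if "u \<in> {1, -1}" "large m0 k n" for u y k n
    using that unfolding large_def by blast
  have "m \<in> orbit_hull p" using reach_orbit_hull[OF assms(3,1) p] .
  then obtain s \<sigma> n where n: "s \<in> {1, -1}" "belt p n \<or> (\<exists>k. branch p k n)"
    "m = (\<lambda>x. s * n (\<sigma> x))"
    unfolding orbit_hull_def by blast
  define y where "y = \<sigma> i"
  have es: "e * s \<in> {1, -1}" "e * m i = (e * s) * n y" using n assms(4) by (auto simp: y_def)
  show ?thesis
  proof (cases "belt p n")
    case True
    then have "\<bar>n y\<bar> = p y" by (simp add: belt_def)
    moreover define u :: int where "u = (if n y < 0 then - 1 else 1)"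
    ultimately have u: "u \<in> {1, -1}" "n y = u * p y" by (auto simp: u_def)
    have eu: "(e * s) * u \<in> {1, -1}" using es(1) u(1) by auto
    have "e * m i = ((e * s) * u) * p y" unfolding es(2) by (simp only: u(2) mult.assoc)
    then show ?thesis using belt_entry[OF eu, of y] by (simp only:)
  next
    case False
    then obtain k where b: "branch p k n" using n by blast
    from large_branch[OF this assms(1)] show ?thesis
    proof (elim disjE exE conjE)
      assume "large m0 k n"
      then show ?thesis unfolding es(2) using large_entry[OF es(1)] by blast
    next
      fix i j
      assume *: "distinct3 i j k" "p i = 1" "p j = 1" "n = p(k := p k + p i * p j)"
      show ?thesis
      proof (cases "y = k")
        case False
        then show ?thesis unfolding es(2) using * belt_entry[OF es(1), of y] by simp
      next
        case True
        \<comment> \<open>Wildness now forces \<open>p k\<close> to be at least 2. The branch at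
          \<open>i\<close> is then large, and its newest entry \<open>p i + p j * p k\<close> is the
          required \<open>p k + 1\<close>.\<close>
        obtain b where "2 \<le> p b" using assms(2) unfolding wild_def by blast
        then have "2 \<le> p k" using distinct3_exhaust[OF *(1), of b] *(2,3) by auto
        then have "large m0 i (p(i := p i + p j * p k))"
          using * by (intro large_child[OF assms(1)]) auto
        from large_entry[OF es(1) this, of i] show ?thesis
          unfolding es(2) using * True by (simp add: add.commute)
      qed
    qed
  qed
qed

section \<open>From seeds to triples\<close>

definition entries :: "imat3 \<Rightarrow> 3 \<Rightarrow> int" where
  "entries B = (\<lambda>i. B $ (i + 1) $ (i + 2))"

lemma add_cycle3 [simp]: "i + 1 + 1 = i + 2" "i + 1 + 2 = i" "i + 2 + 1 = i" "i + 2 + 2 = i + 1" for i :: 3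
  using exhaust_3[of i] by auto

lemma skew_sym_entries:
  assumes "skew_sym B"
  shows "B $ i $ i = 0" "B $ (i + 1) $ i = - entries B (i + 2)" "B $ (i + 2) $ i = entries B (i + 1)"
    "B $ i $ (i + 1) = entries B (i + 2)" "B $ i $ (i + 2) = - entries B (i + 1)"
    "B $ (i + 1) $ (i + 2) = entries B i" "B $ (i + 2) $ (i + 1) = - entries B i"
proof -
  have s: "B $ a $ b = - B $ b $ a" for a b using assms unfolding skew_sym_def by blast
  show "B $ i $ i = 0" using s[of i i] by simp
  show "B $ (i + 1) $ i = - entries B (i + 2)" "B $ i $ (i + 2) = - entries B (i + 1)"
    "B $ (i + 2) $ (i + 1) = - entries B i"
    unfolding entries_def using s[of "i + 1" i] s[of i "i + 2"] s[of "i + 2" "i + 1"] by simp_all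
qed (simp_all add: entries_def)

lemma skew_sym_mut:
  assumes "skew_sym B" shows "skew_sym (mut k B)"
proof -
  have s: "B $ a $ b = - B $ b $ a" for a b using assms unfolding skew_sym_def by blast
  have "sgn a * max (a * b) 0 = - (sgn (- b) * max ((- b) * (- a)) 0)" for a b :: int
    by (auto simp: max_def sgn_if mult.commute zero_less_mult_iff mult_le_0_iff zero_le_mult_iff)
  then have "mut k B $ i $ j = - mut k B $ j $ i" for i j
    unfolding mut_def using s[of i j] s[of j k] s[of k i] by (cases "i = j") auto
  then show ?thesis unfolding skew_sym_def by blast
qed

text \<open>Matrix mutation negates the two entries that involve \<open>k\<close>, which
  \<open>tmut\<close> keeps; hence the global sign. With this choice triples transform exactly as
  degree vectors do.\<close>

lemma entries_mut:
  assumes "skew_sym B" shows "entries (mut k B) = (\<lambda>x. - tmut k (entries B) x)"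
proof -
  note d = distinct3_succ[of k] and e = skew_sym_entries[OF assms]
  have ne: "k \<noteq> k + 1" "k \<noteq> k + 2" "k + 1 \<noteq> k" "k + 2 \<noteq> k" "k + 1 \<noteq> k + 2" "k + 2 \<noteq> k + 1"
    using d by (auto simp: distinct3_def)
  have "sgn a * max (a * b) 0 = - (sgn (- b) * max ((- b) * (- a)) 0)" for a b :: int
    by (auto simp: max_def sgn_if mult.commute zero_less_mult_iff mult_le_0_iff zero_le_mult_iff)
  note this[of "entries B (k + 1)" "entries B (k + 2)"]
  moreover have "entries (mut k B) = (\<lambda>i. mut k B $ (i + 1) $ (i + 2))"
    by (simp add: entries_def)
  ultimately show ?thesis
    unfolding fun_eq_iff distinct3_all[OF d]
    using ne by (simp add: mut_def tmut_def e)
qed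

text \<open>The sign \<open>s\<close> alternates along a walk and is left open; the factor
  \<open>c\<close> between degrees and triples never changes.\<close>

definition matches :: "real \<Rightarrow> (3 \<Rightarrow> real) \<Rightarrow> seed \<Rightarrow> (3 \<Rightarrow> real) \<Rightarrow> (3 \<Rightarrow> int) \<Rightarrow> bool" where
  "matches c t \<Sigma> v m \<longleftrightarrow> (case \<Sigma> of (x, B, h) \<Rightarrow> skew_sym B
     \<and> (\<exists>s \<in> {1, -1}. entries B = (\<lambda>i. s * m i))
     \<and> (\<forall>i. real_of_int (h $ i) = c * m i) \<and> (\<forall>i. x i t = v i))"

lemma deg_mut_entries:
  assumes "skew_sym B"
  shows "deg_mut k B h $ k = - h $ k
    + (if entries B (k + 2) < 0 then - entries B (k + 2) * h $ (k + 1) else 0)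
    + (if 0 < entries B (k + 1) then entries B (k + 1) * h $ (k + 2) else 0)"
proof -
  note d = distinct3_succ[of k] and e = skew_sym_entries[OF assms]
  have "(\<Sum>i\<in>{i. 0 < B $ i $ k}. B $ i $ k * h $ i) = (\<Sum>i\<in>UNIV. if 0 < B $ i $ k then B $ i $ k * h $ i else 0)"
    by (simp add: sum.If_cases)
  also have "\<dots> = (\<Sum>i\<in>{k, k + 1, k + 2}. if 0 < B $ i $ k then B $ i $ k * h $ i else 0)"
    by (simp only: distinct3_UNIV[OF d])
  finally show ?thesis
    using d by (simp add: deg_mut_def e distinct3_def)
qed

lemma exchange_entries:
  assumes "skew_sym B" "pos_pt t"
  shows "exchange k x B t = vmut k (entries B) (\<lambda>i. x i t) k"
proof -
  note d = distinct3_succ[of k] and e = skew_sym_entries[OF assms(1)]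
  have "(\<Prod>i\<in>UNIV. f i) = (\<Prod>i\<in>{k, k + 1, k + 2}. f i)" for f :: "3 \<Rightarrow> real"
    by (simp only: distinct3_UNIV[OF d])
  then show ?thesis
    using d assms(2)
    by (auto simp: exchange_def vmut_def e distinct3_def zero_less_mult_iff mult.commute not_less)
qed

lemma matches_step:
  assumes "matches c t \<Sigma> v m" "pos_pt t"
  shows "matches c t (seed_mut k \<Sigma>) (vmut k m v) (tmut k m)"
proof -
  obtain x B h where \<Sigma>: "\<Sigma> = (x, B, h)" by (cases \<Sigma>)
  from assms(1) obtain s where B: "skew_sym B" and s: "s \<in> {1, -1}" "entries B = (\<lambda>i. s * m i)"
    and h: "\<And>i. real_of_int (h $ i) = c * m i" and x: "\<And>i. x i t = v i"
    unfolding matches_def \<Sigma> prod.case by blast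
  have "entries (mut k B) = (\<lambda>i. - s * tmut k m i)"
    using entries_mut[OF B, of k] tmut_equivariant[OF bij_id s(1), of k m] s(2) by simp
  then have ex: "\<exists>s \<in> {1, -1}. entries (mut k B) = (\<lambda>i. s * tmut k m i)"
    using s(1) by (intro bexI[of _ "- s"]) auto
  have "real_of_int (deg_mut k B h $ i) = c * tmut k m i" for i
  proof (cases "i = k")
    case True
    have "real_of_int (deg_mut k B h $ k) = - (c * m k)
      + (if s * m (k + 2) < 0 then - (s * m (k + 2)) * (c * m (k + 1)) else 0)
      + (if 0 < s * m (k + 1) then s * m (k + 1) * (c * m (k + 2)) else 0)"
      unfolding deg_mut_entries[OF B] s(2) by (simp add: h)
    \<comment> \<open>If \<open>m (k + 1)\<close> and \<open>m (k + 2)\<close> have a common sign,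
      exactly one conditional term is active; otherwise the terms cancel or vanish. So the result
      does not depend on \<open>s\<close>.\<close>
    also have "\<dots> = c * tmut k m k"
      using s(1) by (auto simp: tmut_def sgn_if max_def algebra_simps zero_less_mult_iff mult_le_0_iff)
    finally show ?thesis using True by simp
  next
    case False
    then show ?thesis by (simp add: deg_mut_def tmut_def h)
  qed
  moreover have "vmut k (entries B) v = vmut k m v"
    using s by (auto simp: vmut_def)
  then have "(x(k := exchange k x B)) i t = vmut k m v i" for i
    using exchange_entries[OF B assms(2), of k x] x by (simp add: vmut_def)
  ultimately show ?thesis
    using ex skew_sym_mut[OF B] unfolding matches_def \<Sigma> seed_mut_def by simp
qed

lemma matches_initial:
  assumes "skew_sym A" "pos_pt t" "\<And>i. real_of_int (g $ i) = c * real_of_int (entries A i)"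
  shows "matches c t (initial_cluster, A, g) t (entries A)"
  using assms unfolding matches_def initial_cluster_def by (auto intro!: bexI[of _ 1])

lemma reachable_imp_reach:
  assumes "\<Sigma> \<in> reachable_seeds A g" "skew_sym A" "pos_pt t" "\<And>i. real_of_int (g $ i) = c * real_of_int (entries A i)"
  shows "\<exists>v m. reach t (entries A) v m \<and> matches c t \<Sigma> v m"
  using assms(1)
proof induction
  case init
  show ?case using matches_initial[OF assms(2-4)] reach.refl by blast
next
  case (step \<Sigma> k)
  then show ?case using matches_step[OF _ assms(3)] reach.step by blast
qed

lemma reach_imp_reachable:
  assumes "reach t (entries A) v m" "skew_sym A" "pos_pt t" "\<And>i. real_of_int (g $ i) = c * real_of_int (entries A i)"
  shows "\<exists>\<Sigma> \<in> reachable_seeds A g. matches c t \<Sigma> v m"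
  using assms(1)
proof induction
  case refl
  show ?case using matches_initial[OF assms(2-4)] reachable_seeds.init by blast
next
  case (step v m k)
  then show ?case using matches_step[OF _ assms(3)] reachable_seeds.step by blast
qed

text \<open>Since mutation is an involution on positive values, any positive values can be prescribed
  at a given matrix of the mutation class.\<close>

lemma mutation_class_reach:
  assumes "C \<in> mutation_class A" "skew_sym A" "\<And>i. 0 < v i"
  shows "skew_sym C \<and> (\<exists>t m. \<exists>s \<in> {1, -1}. pos_pt t \<and> reach t (entries A) v m
    \<and> entries C = (\<lambda>i. s * m i))"
  using assms(1,3)
proof (induction arbitrary: v)
  case refl
  have "reach v (entries A) v (entries A)" by (rule reach.refl)
  then show ?case
    using assms(2) refl unfolding pos_pt_def by (auto intro!: exI[of _ v] exI[of _ "entries A"])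
next
  case (step C k)
  define w where "w = vmut k (tmut k (entries C)) v"
  have "0 < w i" for i unfolding w_def using step.prems by (rule vmut_pos)
  from step.IH[of w, OF this] obtain t m s where C: "skew_sym C" and s: "s \<in> {1, -1}"
    and t: "pos_pt t" "reach t (entries A) w m" "entries C = (\<lambda>i. s * m i)"
    by blast
  have "vmut k m w = vmut k (entries C) w" using s t(3) by (auto simp: vmut_def)
  also have "\<dots> = v"
    using vmut_vmut[of v k "tmut k (entries C)"] step.prems by (simp add: w_def)
  finally have "reach t (entries A) v (tmut k m)" using reach.step[OF t(2), of k] by simp
  moreover have "entries (mut k C) = (\<lambda>i. - s * tmut k m i)"
    using entries_mut[OF C, of k] tmut_equivariant[OF bij_id s, of k m] t(3) by simp
  moreover have "- s \<in> {1, -1}" using s by auto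
  ultimately show ?case using skew_sym_mut[OF C] t(1) by blast
qed

section \<open>Finiteness, countability and the kernel\<close>

lemma finite_bounded_skew_sym: "finite {B. skew_sym B \<and> (\<forall>i. \<bar>entries B i\<bar> \<le> K)}"
proof (rule finite_imageD)
  have "\<bar>a\<bar> \<le> K \<longleftrightarrow> a \<in> {- K..K}" for a by auto
  then have "{f. \<forall>i. \<bar>f i\<bar> \<le> K} = (UNIV :: 3 set) \<rightarrow>\<^sub>E {- K..K}"
    by (simp add: PiE_UNIV_domain Pi_def)
  then have "finite {f :: 3 \<Rightarrow> int. \<forall>i. \<bar>f i\<bar> \<le> K}" by (simp add: finite_PiE)
  then show "finite (entries ` {B. skew_sym B \<and> (\<forall>i. \<bar>entries B i\<bar> \<le> K)})"
    by (rule rev_finite_subset) auto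
  show "inj_on entries {B. skew_sym B \<and> (\<forall>i. \<bar>entries B i\<bar> \<le> K)}"
  proof (rule inj_onI)
    fix B C assume "B \<in> {B. skew_sym B \<and> (\<forall>i. \<bar>entries B i\<bar> \<le> K)}"
      "C \<in> {B. skew_sym B \<and> (\<forall>i. \<bar>entries B i\<bar> \<le> K)}" and eq: "entries B = entries C"
    then have s: "skew_sym B" "skew_sym C" by auto
    have "B $ i $ j = C $ i $ j" for i j
      using distinct3_exhaust[OF distinct3_succ[of i], of j] eq
      by (auto simp: skew_sym_entries[OF s(1)] skew_sym_entries[OF s(2)])
    then show "B = C" by (simp add: vec_eq_iff)
  qed
qed

lemma acyclic_mixed:
  assumes "is_acyclic C" "skew_sym C"
  shows "\<not> (\<forall>i. 0 < entries C i)" "\<not> (\<forall>i. entries C i < 0)"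
proof -
  have no_cycle: False if "(1, a) \<in> quiver_arrows C" "(a, b) \<in> quiver_arrows C" "(b, 1) \<in> quiver_arrows C" for a b
    using that assms(1) unfolding is_acyclic_def acyclic_def
    by (meson r_into_trancl' trancl_into_trancl)
  note e = skew_sym_entries[OF assms(2), of 1]
  show "\<not> (\<forall>i. 0 < entries C i)"
    using no_cycle[of "1 + 1" "1 + 2"] e by (auto simp: quiver_arrows_def simp del: one_add_one)
  show "\<not> (\<forall>i. entries C i < 0)"
    using no_cycle[of "1 + 2" "1 + 1"] e by (auto simp: quiver_arrows_def simp del: one_add_one)
qed

lemma countable_reachable_seeds: "countable (reachable_seeds A g)"
proof -
  have "reachable_seeds A g \<subseteq> range (\<lambda>ks. foldr seed_mut ks (initial_cluster, A, g))"
  proof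
    fix \<Sigma> assume "\<Sigma> \<in> reachable_seeds A g"
    then show "\<Sigma> \<in> range (\<lambda>ks. foldr seed_mut ks (initial_cluster, A, g))"
    proof induction
      case init
      show ?case by (rule range_eqI[of _ _ "[]"]) simp
    next
      case (step \<Sigma> k)
      then obtain ks where "\<Sigma> = foldr seed_mut ks (initial_cluster, A, g)" by blast
      then show ?case by (intro range_eqI[of _ _ "k # ks"]) simp
    qed
  qed
  then show ?thesis by (rule countable_subset) simp
qed

lemma countable_cluster_vars: "countable (cluster_vars_of_degree A g d)"
proof -
  have "cluster_vars_of_degree A g d \<subseteq> (\<Union>\<Sigma>\<in>reachable_seeds A g. range (fst \<Sigma>))"
    unfolding cluster_vars_of_degree_def by force
  then show ?thesis
    by (rule countable_subset) (auto intro!: countable_UN countable_reachable_seeds)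
qed

text \<open>The rows of \<open>A *v g = 0\<close> say that the cross product of
  \<open>entries A\<close> and \<open>g\<close> vanishes. The factor is real because
  \<open>g\<close> need not be an integer multiple of \<open>entries A\<close>.\<close>

lemma kernel_entries:
  assumes "skew_sym A" "A *v g = 0" "entries A j \<noteq> 0"
  shows "\<exists>c. \<forall>i. real_of_int (g $ i) = c * real_of_int (entries A i)"
proof -
  have *: "entries A (i + 2) * g $ (i + 1) = entries A (i + 1) * g $ (i + 2)" for i
  proof -
    have "0 = (A *v g) $ i" using assms(2) by simp
    also have "\<dots> = (\<Sum>j\<in>{i, i + 1, i + 2}. A $ i $ j * g $ j)"
      unfolding matrix_vector_mult_def distinct3_UNIV[OF distinct3_succ[of i], symmetric] by simp
    finally show ?thesis
      using distinct3_succ[of i] by (simp add: skew_sym_entries[OF assms(1)] distinct3_def)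
  qed
  have "entries A j * g $ i = entries A i * g $ j" for i
    using distinct3_exhaust[OF distinct3_succ[of j], of i] *[of j] *[of "j + 1"] *[of "j + 2"]
    by (auto simp: add_cycle3)
  then have "real_of_int (entries A j) * g $ i = entries A i * g $ j" for i
    by (metis of_int_mult)
  then show ?thesis
    using assms(3) by (intro exI[of _ "g $ j / entries A j"]) (simp add: field_simps)
qed

lemma connected_entries_nonzero:
  assumes "quiver_connected A" "skew_sym A"
  shows "\<exists>j. entries A j \<noteq> 0"
proof (rule ccontr)
  assume "\<not> ?thesis"
  then have "A $ a $ b = 0" for a b
    using distinct3_exhaust[OF distinct3_succ[of a], of b] skew_sym_entries[OF assms(2), of a] by auto
  then have "{(a, b). A $ a $ b \<noteq> 0 \<or> A $ b $ a \<noteq> 0} = {}" by simp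
  then have "(1, 2 :: 3) \<in> {}\<^sup>*" using assms(1) unfolding quiver_connected_def by metis
  then show False by simp
qed

section \<open>Infinitude and balance\<close>

theorem mainTheorem2:
  fixes A :: imat3 and g :: "int^3"
  assumes "skew_sym A"
    and "quiver_connected A"
    and "mutation_acyclic A"
    and "mutation_infinite A"
    and "g \<noteq> 0"
    and "A *v g = 0"
  shows "(\<forall>d. degree_occurs A g d \<longrightarrow> infinite (cluster_vars_of_degree A g d))
         \<and> balanced_grading A g"
proof -
  obtain c where c: "\<And>i. real_of_int (g $ i) = c * real_of_int (entries A i)"
    using connected_entries_nonzero[OF assms(2,1)] kernel_entries[OF assms(1,6)] by blast
  obtain C where C: "C \<in> mutation_class A" "is_acyclic C"
    using assms(3) unfolding mutation_acyclic_def by blast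
  \<comment> \<open>The values 1 are prescribed at the acyclic matrix \<open>C\<close>;
    \<open>t\<close> is the point that they induce at the initial cluster.\<close>
  obtain t m0 s where t: "pos_pt t" "reach t (entries A) (\<lambda>_. 1) m0"
    and s: "s \<in> {1, -1}" "entries C = (\<lambda>i. s * m0 i)" and "skew_sym C"
    using mutation_class_reach[OF C(1) assms(1), of "\<lambda>_. 1", OF zero_less_one] by blast
  define p where "p = (\<lambda>i. \<bar>m0 i\<bar>)"
  have belt: "belt p m0"
    using acyclic_mixed[OF C(2) \<open>skew_sym C\<close>] s unfolding belt_def p_def by auto
  have p: "0 \<le> p i" for i by (simp add: p_def)
  have tpos: "0 < t i" for i using t(1) by (simp add: pos_pt_def)
  have root_to_initial: "reach (\<lambda>_. 1) m0 t (entries A)" using reach_sym[OF t(2) tpos] .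
  have wild: "wild p"
  proof (rule ccontr)
    assume tame: "\<not> wild p"
    have "mutation_class A \<subseteq> {B. skew_sym B \<and> (\<forall>i. \<bar>entries B i\<bar> \<le> 2 + sum p UNIV)}"
    proof
      fix B assume "B \<in> mutation_class A"
      then have *: "skew_sym B"
        "\<exists>t' m. \<exists>s \<in> {1, -1}. pos_pt t' \<and> reach t' (entries A) (\<lambda>_. 1) m \<and> entries B = (\<lambda>i. s * m i)"
        using mutation_class_reach[OF _ assms(1), of B "\<lambda>_. 1", OF _ zero_less_one] by blast+
      then obtain t' m s where m: "s \<in> {1, -1}" "reach t' (entries A) (\<lambda>_. 1) m" "entries B = (\<lambda>i. s * m i)"
        by blast
      have "m \<in> orbit_hull p" if "entries A \<in> orbit_hull p"
        using m(2) by induction (auto intro: that orbit_hull_tmut p)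
      then have "\<bar>m i\<bar> \<le> 2 + sum p UNIV" for i
        using orbit_hull_tame[OF _ tame p] reach_orbit_hull[OF root_to_initial belt p] by blast
      then show "B \<in> {B. skew_sym B \<and> (\<forall>i. \<bar>entries B i\<bar> \<le> 2 + sum p UNIV)}"
        using *(1) m(1,3) by (auto simp: abs_mult)
    qed
    then show False
      using assms(4) finite_bounded_skew_sym finite_subset unfolding mutation_infinite_def by blast
  qed
  have unbounded: "\<exists>w \<in> cluster_vars_of_degree A g (e * d). M \<le> w t"
    if occurs: "degree_occurs A g d" and sign: "e \<in> {1, -1}" for d e M
  proof -
    obtain x B h i where seed: "(x, B, h) \<in> reachable_seeds A g" "h $ i = d"
      using occurs unfolding degree_occurs_def cluster_vars_of_degree_def by blast
    obtain v m where vm: "reach t (entries A) v m" "matches c t (x, B, h) v m"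
      using reachable_imp_reach[OF seed(1) assms(1) t(1) c] by blast
    obtain v' m' i' where *: "reach (\<lambda>_. 1) m0 v' m'" "m' i' = e * m i" "M \<le> v' i'"
      using reach_unbounded[OF belt wild reach_trans[OF vm(1) root_to_initial] sign] by blast
    obtain x' B' h' where seed': "(x', B', h') \<in> reachable_seeds A g" "matches c t (x', B', h') v' m'"
      using reach_imp_reachable[OF reach_trans[OF *(1) t(2)] assms(1) t(1) c] by auto
    have "real_of_int (h' $ i') = real_of_int (e * d)"
      using seed'(2) vm(2) *(2) seed(2) unfolding matches_def by auto
    then have "h' $ i' = e * d" by linarith
    moreover have "M \<le> x' i' t" using seed'(2) *(3) unfolding matches_def by auto
    ultimately show ?thesis
      using seed'(1) unfolding cluster_vars_of_degree_def by blast
  qed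
  have inf: "infinite (cluster_vars_of_degree A g (e * d))"
    if occurs: "degree_occurs A g d" and sign: "e \<in> {1, -1}" for d e
  proof
    assume "finite (cluster_vars_of_degree A g (e * d))"
    then have "bdd_above ((\<lambda>w. w t) ` cluster_vars_of_degree A g (e * d))"
      by (intro bdd_above_finite) simp
    then obtain M where "\<And>w. w \<in> cluster_vars_of_degree A g (e * d) \<Longrightarrow> w t \<le> M"
      unfolding bdd_above_def by blast
    then show False using unbounded[OF occurs sign, of "M + 1"] by fastforce
  qed
  have "\<exists>f. bij_betw f (cluster_vars_of_degree A g d) (cluster_vars_of_degree A g (- d))" for d
  proof (cases "degree_occurs A g d")
    case True
    then have "infinite (cluster_vars_of_degree A g d)" "infinite (cluster_vars_of_degree A g (- d))"
      using inf[of d 1] inf[of d "-1"] by auto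
    then show ?thesis
      \<comment> \<open>Both sets are countably infinite, so each is in bijection with the natural
        numbers.\<close>
      using countableE_infinite[OF countable_cluster_vars]
      by (meson bij_betw_inv bij_betw_trans)
  next
    case False
    \<comment> \<open>If \<open>-d\<close> occurred, then so would \<open>d\<close>, by
      \<open>inf\<close> with sign -1; thus both sets are empty.\<close>
    then have "\<not> degree_occurs A g (- d)"
      using inf[of "- d" "-1"] by (auto simp: degree_occurs_def)
    then show ?thesis using False by (simp add: degree_occurs_def bij_betw_def)
  qed
  then show ?thesis
    using inf[of _ 1] unfolding balanced_grading_def by auto
qed

end
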